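(* Let $Q$ be a finite quiver, let $M\in\mathrm{rep}_{\mathbb{C}}(Q)$ be straight with straightening basis $B$, and let $\mathbf{e}\in\mathbb{Z}^{Q_0}$. Then the torus $T_M$ acts on $\mathrm{Gr}_{\mathbf{e}}(M)$ with finitely many fixed points.
   Context: A quiver $Q$ has vertex set $Q_0$ and arrow set $Q_1$; an arrow $a$ has source $s_a$ and target $t_a$. $\mathrm{rep}_{\mathbb{C}}(Q)$ is the category of finite-dimensional complex representations $M=((M^{(i)})_{i\in Q_0},(M_a)_{a\in Q_1})$. The quiver Grassmannian $\mathrm{Gr}_{\mathbf e}(M)$ is the closed subvariety of $\prod_{i\in Q_0}\mathrm{Gr}_{e_i}(M^{(i)})$ of all subrepresentations $U\subseteq M$ with $\dim U^{(i)}=e_i$ for all $i$ (empty if some $e_i<0$). For a basis $B=\{b^{(i)}_k\}$ of $\bigoplus_{i} M^{(i)}$ consisting of bases of the $M^{(i)}$, the coefficient quiver $Q(M,B)$ has vertex set $B$ and an arrow $b^{(i)}_k\to b^{(j)}_\ell$ for each $(a:i\to j)\in Q_1$ such that the coefficient of $b^{(j)}_\ell$ in $M_ab^{(i)}_k$ is non-zero. $M$ is straight if for some $B$ every connected component of $Q(M,B)$ is an equioriented string $\bullet\to\cdots\to\bullet$ (possibly a single vertex); such $B$ is a straightening basis. Torus $T_M$: let $d$ be the number of connected components of $Q(M,B)$ and $c$ the number of arrows of the supporting subquiver $\mathrm{supp}\,M\subseteq Q$ (the vertices $i$ with $M^{(i)}\neq0$ and arrows $a$ with $M_a\ne0$).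 $T_M:=(\mathbb{C}^* )^{d+c}$, with elements $((\gamma_i)_{i\in[d]},(\nu_j)_{j\in[c]})$, acts on $\bigoplus_iM^{(i)}$ by scaling basis vectors: it scales the starting vertex of the $i$-th string by $\gamma_i$, and along each arrow of $Q(M,B)$ the scaling factor is multiplied by $\nu_j$, where $j$ is the label of the underlying arrow of $Q$. This induces an action on $\mathrm{Gr}_{\mathbf e}(M)$, $U\mapsto t.U$. *)

theory Defs
  imports
    Complex_Main
    "HOL-Algebra.Group_Action"
    "HOL-Algebra.Product_Groups"
    "Graph_Theory.Digraph_Isomorphism"
begin

text \<open>
  Quivers are the multidigraphs \<open>pre_digraph\<close> of \<open>Graph_Theory\<close> (loops and parallel arcs allowed);
  a finite quiver is a \<open>fin_digraph\<close>, and \<open>tail\<close> and \<open>head\<close> are the source and target maps.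

  The spaces \<open>rep_space M i\<close> of a representation are subspaces of one ambient complex vector space
  (additive group \<open>'v\<close>, scalar multiplication \<open>scl M\<close>). They are not assumed to be independent in
  it; direct sums are therefore external, i.e. families indexed by the vertices. Only the values
  of \<open>rep_space M\<close> on vertices, of \<open>arc_map M\<close> on arcs, and of \<open>arc_map M a\<close> on the space at the
  source of \<open>a\<close> are relevant.
\<close>

record ('i, 'a, 'v) quiver_rep =
  scl :: "complex \<Rightarrow> 'v \<Rightarrow> 'v"
  rep_space :: "'i \<Rightarrow> 'v set"
  arc_map :: "'a \<Rightarrow> 'v \<Rightarrow> 'v"

definition linear_map_between ::
    "(complex \<Rightarrow> 'v \<Rightarrow> 'v) \<Rightarrow> 'v set \<Rightarrow> 'v set \<Rightarrow> ('v::ab_group_add \<Rightarrow> 'v) \<Rightarrow> bool" where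
  "linear_map_between s V W f \<longleftrightarrow>
     f ` V \<subseteq> W \<and>
     (\<forall>x\<in>V. \<forall>y\<in>V. f (x + y) = f x + f y) \<and>
     (\<forall>c. \<forall>x\<in>V. f (s c x) = s c (f x))"

definition is_rep ::
    "('i, 'a) pre_digraph \<Rightarrow> ('i, 'a, 'v::ab_group_add) quiver_rep \<Rightarrow> bool" where
  "is_rep Q M \<longleftrightarrow>
     vector_space (scl M) \<and>
     (\<forall>i\<in>verts Q. \<exists>S. finite S \<and> module.span (scl M) S = rep_space M i) \<and>
     (\<forall>a\<in>arcs Q. linear_map_between (scl M) (rep_space M (tail Q a)) (rep_space M (head Q a))
                   (arc_map M a))"

definition supp ::
    "('i, 'a) pre_digraph \<Rightarrow> ('i, 'a, 'v::ab_group_add) quiver_rep \<Rightarrow> ('i, 'a) pre_digraph" where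
  "supp Q M = Q\<lparr> verts := {i \<in> verts Q. rep_space M i \<noteq> {0}},
                 arcs := {a \<in> arcs Q. \<exists>x\<in>rep_space M (tail Q a). arc_map M a x \<noteq> 0} \<rparr>"

definition quiver_Grassmannian ::
    "('i, 'a) pre_digraph \<Rightarrow> ('i, 'a, 'v::ab_group_add) quiver_rep \<Rightarrow> ('i \<Rightarrow> int) \<Rightarrow> ('i \<Rightarrow> 'v set) set"
  where
  "quiver_Grassmannian Q M e =
     {U \<in> \<Pi>\<^sub>E i\<in>verts Q. {W. module.subspace (scl M) W \<and> W \<subseteq> rep_space M i \<and>
                             int (vector_space.dim (scl M) W) = e i}.
      \<forall>a\<in>arcs Q. arc_map M a ` U (tail Q a) \<subseteq> U (head Q a)}"

definition is_basis ::
    "('i, 'a) pre_digraph \<Rightarrow> ('i, 'a, 'v::ab_group_add) quiver_rep \<Rightarrow> ('i \<Rightarrow> 'v set) \<Rightarrow> bool" where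
  "is_basis Q M B \<longleftrightarrow>
     (\<forall>i\<in>verts Q. \<not> module.dependent (scl M) (B i) \<and> module.span (scl M) (B i) = rep_space M i)"

text \<open>
  A vertex of the coefficient quiver is a pair \<open>(i, b)\<close> with \<open>b \<in> B i\<close>; the arrow from
  \<open>(tail Q a, b)\<close> to \<open>(head Q a, b')\<close> arising from \<open>a\<close> is the triple \<open>(a, b, b')\<close>.
\<close>

definition coeff_quiver ::
    "('i, 'a) pre_digraph \<Rightarrow> ('i, 'a, 'v::ab_group_add) quiver_rep \<Rightarrow> ('i \<Rightarrow> 'v set) \<Rightarrow>
     ('i \<times> 'v, 'a \<times> 'v \<times> 'v) pre_digraph" where
  "coeff_quiver Q M B =
     \<lparr> verts = Sigma (verts Q) B,
       arcs = {(a, b, b'). a \<in> arcs Q \<and> b \<in> B (tail Q a) \<and> b' \<in> B (head Q a) \<and>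
                 module.representation (scl M) (B (head Q a)) (arc_map M a b) b' \<noteq> 0},
       tail = (\<lambda>(a, b, b'). (tail Q a, b)),
       head = (\<lambda>(a, b, b'). (head Q a, b')) \<rparr>"

definition conn_components :: "('x, 'y) pre_digraph \<Rightarrow> ('x, 'y) pre_digraph set" where
  "conn_components G = {C. pre_digraph.max_subgraph G Digraph_Component.connected C}"

text \<open>The string with \<open>n\<close> arrows: \<open>0 \<rightarrow> 1 \<rightarrow> \<dots> \<rightarrow> n\<close>.\<close>

definition equioriented_string :: "nat \<Rightarrow> (nat, nat) pre_digraph" where
  "equioriented_string n = \<lparr> verts = {..n}, arcs = {..<n}, tail = (\<lambda>k. k), head = Suc \<rparr>"

definition straightening_basis ::
    "('i, 'a) pre_digraph \<Rightarrow> ('i, 'a, 'v::ab_group_add) quiver_rep \<Rightarrow> ('i \<Rightarrow> 'v set) \<Rightarrow> bool" where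
  "straightening_basis Q M B \<longleftrightarrow>
     is_basis Q M B \<and>
     (\<forall>C\<in>conn_components (coeff_quiver Q M B). \<exists>n. digraph_iso (equioriented_string n) C)"

definition straight ::
    "('i, 'a) pre_digraph \<Rightarrow> ('i, 'a, 'v::ab_group_add) quiver_rep \<Rightarrow> bool" where
  "straight Q M \<longleftrightarrow> (\<exists>B. straightening_basis Q M B)"

definition Cstar :: "complex monoid" where
  "Cstar = \<lparr> carrier = UNIV - {0}, monoid.mult = (*), one = 1 \<rparr>"

text \<open>
  The torus is indexed by the \<open>d\<close> components of the coefficient quiver and the \<open>c\<close> arrows of the
  supporting subquiver themselves, instead of numbering them by \<open>1, \<dots>, d\<close> and \<open>1, \<dots>, c\<close>.
\<close>

definition torus ::
    "('i, 'a) pre_digraph \<Rightarrow> ('i, 'a, 'v::ab_group_add) quiver_rep \<Rightarrow> ('i \<Rightarrow> 'v set) \<Rightarrow>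
     ((('i \<times> 'v, 'a \<times> 'v \<times> 'v) pre_digraph \<Rightarrow> complex) \<times> ('a \<Rightarrow> complex)) monoid" where
  "torus Q M B =
     DirProd (product_group (conn_components (coeff_quiver Q M B)) (\<lambda>_. Cstar))
             (product_group (arcs (supp Q M)) (\<lambda>_. Cstar))"

text \<open>
  \<open>scaled_by Q M B t x w\<close>: the torus element \<open>t = (\<gamma>, \<nu>)\<close> scales the basis vector \<open>x\<close> by \<open>w\<close>.
\<close>

inductive scaled_by ::
    "('i, 'a) pre_digraph \<Rightarrow> ('i, 'a, 'v::ab_group_add) quiver_rep \<Rightarrow> ('i \<Rightarrow> 'v set) \<Rightarrow>
     (('i \<times> 'v, 'a \<times> 'v \<times> 'v) pre_digraph \<Rightarrow> complex) \<times> ('a \<Rightarrow> complex) \<Rightarrow>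
     'i \<times> 'v \<Rightarrow> complex \<Rightarrow> bool"
  for Q :: "('i, 'a) pre_digraph" and M :: "('i, 'a, 'v::ab_group_add) quiver_rep"
    and B :: "'i \<Rightarrow> 'v set"
    and t :: "(('i \<times> 'v, 'a \<times> 'v \<times> 'v) pre_digraph \<Rightarrow> complex) \<times> ('a \<Rightarrow> complex)" where
  start: "\<lbrakk> C \<in> conn_components (coeff_quiver Q M B); x \<in> verts C; \<forall>\<alpha>\<in>arcs C. head C \<alpha> \<noteq> x \<rbrakk>
          \<Longrightarrow> scaled_by Q M B t x (fst t C)"
| step: "\<lbrakk> scaled_by Q M B t x w; (a, b, b') \<in> arcs (coeff_quiver Q M B);
           tail (coeff_quiver Q M B) (a, b, b') = x \<rbrakk>
         \<Longrightarrow> scaled_by Q M B t (head (coeff_quiver Q M B) (a, b, b')) (w * snd t a)"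

text \<open>For a straightening basis \<open>B\<close>, each basis vector is scaled by exactly one factor.\<close>

definition weight ::
    "('i, 'a) pre_digraph \<Rightarrow> ('i, 'a, 'v::ab_group_add) quiver_rep \<Rightarrow> ('i \<Rightarrow> 'v set) \<Rightarrow>
     (('i \<times> 'v, 'a \<times> 'v \<times> 'v) pre_digraph \<Rightarrow> complex) \<times> ('a \<Rightarrow> complex) \<Rightarrow>
     'i \<times> 'v \<Rightarrow> complex" where
  "weight Q M B t x = (THE w. scaled_by Q M B t x w)"

text \<open>The action on the \<open>i\<close>-th summand: the linear extension of the scaling of \<open>B i\<close>.\<close>

definition act_vec ::
    "('i, 'a) pre_digraph \<Rightarrow> ('i, 'a, 'v::ab_group_add) quiver_rep \<Rightarrow> ('i \<Rightarrow> 'v set) \<Rightarrow>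
     (('i \<times> 'v, 'a \<times> 'v \<times> 'v) pre_digraph \<Rightarrow> complex) \<times> ('a \<Rightarrow> complex) \<Rightarrow>
     'i \<Rightarrow> 'v \<Rightarrow> 'v" where
  "act_vec Q M B t i v =
     (\<Sum>b\<in>B i. scl M (module.representation (scl M) (B i) v b * weight Q M B t (i, b)) b)"

definition act ::
    "('i, 'a) pre_digraph \<Rightarrow> ('i, 'a, 'v::ab_group_add) quiver_rep \<Rightarrow> ('i \<Rightarrow> 'v set) \<Rightarrow>
     (('i \<times> 'v, 'a \<times> 'v \<times> 'v) pre_digraph \<Rightarrow> complex) \<times> ('a \<Rightarrow> complex) \<Rightarrow>
     ('i \<Rightarrow> 'v set) \<Rightarrow> ('i \<Rightarrow> 'v set)" where
  "act Q M B t U = (\<lambda>i\<in>verts Q. act_vec Q M B t i ` U i)"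

end

theory Submission
  imports Defs
begin

text \<open>
  Along the strings of \<open>B\<close> every basis vector gets a well-defined weight, a character of the torus,
  and the weights at the two ends of an arrow over \<open>a\<close> differ by the coordinate \<open>\<nu>\<^sub>a\<close>. Hence the
  diagonal operators given by a torus element \<open>t\<close> commute with \<open>M\<^sub>a\<close> up to the nonzero factor
  \<open>\<nu>\<^sub>a\<close>, so \<open>t\<close> maps subrepresentations to subrepresentations. The element with all \<open>\<nu>\<^sub>a = 2\<close> and
  with distinct powers of 3 as \<open>\<gamma>\<close>-coordinates scales the vector at position \<open>p\<close> of the \<open>i\<close>-th
  string by \<open>3\<^sup>i 2\<^sup>p\<close>. These factors are pairwise distinct, so a fixed point is spanned by a
  subset of the basis, and there are finitely many such subsets.
\<close>

section \<open>Diagonal operators with respect to a finite basis\<close>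

locale finite_basis = vector_space scale
  for scale :: "'k::field \<Rightarrow> 'v::ab_group_add \<Rightarrow> 'v" +
  fixes B :: "'v set"
  assumes independent_B: "independent B"
    and finite_B: "finite B"
begin

text \<open>The diagonal operator with eigenvalue \<open>w b\<close> on \<open>b\<close>. Since
  \<open>representation B\<close> vanishes on vectors outside \<open>span B\<close>, these are sent
  to 0, so composition is an identity on the whole ambient space, whereas additivity concerns the
  span.\<close>

definition diag_scale :: "('v \<Rightarrow> 'k) \<Rightarrow> 'v \<Rightarrow> 'v" where
  "diag_scale w v = (\<Sum>b\<in>B. scale (representation B v b * w b) b)"

lemma representation_sum_scale:
  "representation B (\<Sum>b\<in>B. scale (c b) b) = (\<lambda>b. if b \<in> B then c b else 0)"
proof (rule representation_eqI[OF independent_B])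
  show "(\<Sum>b\<in>B. scale (c b) b) \<in> span B"
    by (intro span_sum span_scale span_base)
  show "finite {b. (if b \<in> B then c b else 0) \<noteq> 0}"
    using finite_B by (rule rev_finite_subset) auto
  show "(\<Sum>b | (if b \<in> B then c b else 0) \<noteq> 0. scale (if b \<in> B then c b else 0) b)
      = (\<Sum>b\<in>B. scale (c b) b)"
    by (rule sum.mono_neutral_cong_left) (use finite_B in \<open>auto split: if_splits\<close>)
qed (auto split: if_splits)

lemma diag_scale_in_span: "diag_scale w v \<in> span B"
  unfolding diag_scale_def by (intro span_sum span_scale span_base)

lemma representation_diag_scale:
  "representation B (diag_scale w v) b = representation B v b * w b"
  using representation_ne_zero[of B v b]
  unfolding diag_scale_def representation_sum_scale by auto

lemma diag_scale_compose:
  "diag_scale w (diag_scale w' v) = diag_scale (\<lambda>b. w b * w' b) v"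
  unfolding diag_scale_def[of w] diag_scale_def[of "\<lambda>b. w b * w' b"]
  by (simp only: representation_diag_scale mult_ac)

lemma diag_scale_one:
  assumes "v \<in> span B" "\<And>b. b \<in> B \<Longrightarrow> w b = 1"
  shows "diag_scale w v = v"
  using sum_representation_eq[OF independent_B _ finite_B, of v] assms by (simp add: diag_scale_def)

lemma diag_scale_cong:
  assumes "\<And>b. b \<in> B \<Longrightarrow> w b = w' b"
  shows "diag_scale w v = diag_scale w' v"
  using assms by (simp add: diag_scale_def)

lemma diag_scale_add:
  assumes "u \<in> span B" "v \<in> span B"
  shows "diag_scale w (u + v) = diag_scale w u + diag_scale w v"
  using assms
  by (simp add: diag_scale_def representation_add[OF independent_B] distrib_right scale_left_distrib sum.distrib)

lemma diag_scale_scale: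
  assumes "v \<in> span B"
  shows "diag_scale w (scale c v) = scale c (diag_scale w v)"
  using assms by (simp add: diag_scale_def representation_scale[OF independent_B] scale_sum_right mult_ac)

lemma diag_scale_zero: "diag_scale w 0 = 0"
  by (simp add: diag_scale_def representation_zero)

lemma diag_scale_sum:
  assumes "\<And>i. i \<in> I \<Longrightarrow> v i \<in> span B"
  shows "diag_scale w (sum v I) = (\<Sum>i\<in>I. diag_scale w (v i))"
  using assms
  by (induction I rule: infinite_finite_induct)
    (auto simp: diag_scale_zero diag_scale_add span_sum)

lemma subspace_diag_scale_image:
  assumes "subspace U" "U \<subseteq> span B"
  shows "subspace (diag_scale w ` U)"
proof (rule subspaceI)
  show "0 \<in> diag_scale w ` U"
    using subspace_0[OF assms(1)] diag_scale_zero by (metis image_eqI)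
next
  fix x y assume "x \<in> diag_scale w ` U" "y \<in> diag_scale w ` U"
  then obtain u v where "u \<in> U" "v \<in> U" "x = diag_scale w u" "y = diag_scale w v" by auto
  then show "x + y \<in> diag_scale w ` U"
    using diag_scale_add[of u v w] assms subspace_add by (metis image_eqI subsetD)
next
  fix c x assume "x \<in> diag_scale w ` U"
  then obtain u where "u \<in> U" "x = diag_scale w u" by auto
  then show "scale c x \<in> diag_scale w ` U"
    using diag_scale_scale[of u w c] subspace_scale[OF assms(1), of u c] assms(2)
    by (metis image_eqI subsetD)
qed

text \<open>A basis \<open>S\<close> of \<open>U\<close> is mapped to a spanning set of the image
  with at most \<open>card S\<close> elements.\<close>

lemma dim_diag_scale_image_le:
  assumes "U \<subseteq> span B"
  shows "dim (diag_scale w ` U) \<le> dim U"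
proof -
  obtain S where S: "S \<subseteq> U" "independent S" "U \<subseteq> span S" "card S = dim U"
    by (rule basis_exists)
  have finS: "finite S"
    using independent_span_bound[OF finite_B S(2)] S(1) assms by auto
  have "diag_scale w ` U \<subseteq> span (diag_scale w ` S)"
  proof clarify
    fix u assume "u \<in> U"
    then have "u = (\<Sum>s\<in>S. scale (representation S u s) s)"
      using sum_representation_eq[OF S(2) _ finS] S(3) by auto
    then have "diag_scale w u = (\<Sum>s\<in>S. diag_scale w (scale (representation S u s) s))"
      using diag_scale_sum[of S "\<lambda>s. scale (representation S u s) s" w] S(1) assms
      by (metis span_scale subsetD)
    also have "\<dots> = (\<Sum>s\<in>S. scale (representation S u s) (diag_scale w s))"
      using S(1) assms by (intro sum.cong) (auto simp: diag_scale_scale subset_iff)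
    finally show "diag_scale w u \<in> span (diag_scale w ` S)"
      by (auto intro: span_sum span_scale span_base)
  qed
  then show ?thesis
    using dim_le_card[of _ "diag_scale w ` S"] finS card_image_le[OF finS, of "diag_scale w"] S(4)
    by (metis finite_imageI le_trans)
qed

lemma diag_scale_inverse:
  assumes "v \<in> span B" "\<And>b. b \<in> B \<Longrightarrow> w b \<noteq> 0"
  shows "diag_scale (\<lambda>b. inverse (w b)) (diag_scale w v) = v"
  using assms by (simp add: diag_scale_compose diag_scale_one)

text \<open>The operator with the inverse eigenvalues maps the image back onto \<open>U\<close>, so
  the preceding inequality applies in both directions.\<close>

lemma dim_diag_scale_image:
  assumes "U \<subseteq> span B" "\<And>b. b \<in> B \<Longrightarrow> w b \<noteq> 0"
  shows "dim (diag_scale w ` U) = dim U"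
proof (rule antisym)
  have "diag_scale (\<lambda>b. inverse (w b)) ` diag_scale w ` U = U"
    using diag_scale_inverse[OF _ assms(2)] assms(1)
    by (auto simp: image_image subset_iff intro: rev_image_eqI)
  then show "dim U \<le> dim (diag_scale w ` U)"
    using dim_diag_scale_image_le[of "diag_scale w ` U" "\<lambda>b. inverse (w b)"]
      diag_scale_in_span by auto
qed (rule dim_diag_scale_image_le[OF assms(1)])

text \<open>Applying \<open>D - w b\<^sub>1\<close> to a vector of \<open>U\<close>, where \<open>D\<close> is the diagonal operator, kills its
  \<open>b\<^sub>1\<close>-coordinate and keeps the set of the other nonzero coordinates.\<close>

lemma basis_in_invariant_subspace:
  assumes U: "subspace U" "U \<subseteq> span B"
    and inv: "diag_scale w ` U \<subseteq> U" and inj: "inj_on w B"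
    and u: "u \<in> U" "representation B u b \<noteq> 0"
  shows "b \<in> U"
  using u
proof (induction "card {b. representation B u b \<noteq> 0}" arbitrary: u rule: less_induct)
  case less
  let ?R = "representation B"
  have span: "u \<in> span B" using less.prems U by auto
  have bB: "b \<in> B" using less.prems representation_ne_zero by blast
  show ?case
  proof (cases "{b. ?R u b \<noteq> 0} = {b}")
    case True
    then have "scale (?R u b) b = u"
      using sum_nonzero_representation_eq[OF independent_B span] by simp
    then have "b = scale (inverse (?R u b)) u"
      using less.prems(2) by (metis scale_scale left_inverse scale_one)
    then show ?thesis using subspace_scale[OF U(1) less.prems(1)] by metis
  next
    case False
    then obtain b1 where b1: "?R u b1 \<noteq> 0" "b1 \<noteq> b" using less.prems by auto
    define u' where "u' = diag_scale w u - scale (w b1) u"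
    have R: "?R u' c = ?R u c * (w c - w b1)" for c
      unfolding u'_def representation_diff[OF independent_B span_scale[OF span] diag_scale_in_span]
        representation_scale[OF independent_B span] representation_diag_scale
      by (simp add: algebra_simps)
    have b1B: "b1 \<in> B" using b1 representation_ne_zero by blast
    have "u' \<in> U"
      unfolding u'_def using inv less.prems U by (intro subspace_diff subspace_scale) auto
    \<comment> \<open>Distinct eigenvalues make the factor \<open>w b - w b1\<close> nonzero, so the
      coordinate at \<open>b\<close> survives.\<close>
    moreover have "?R u' b \<noteq> 0"
      using R less.prems inj_onD[OF inj _ bB b1B] b1 by auto
    moreover have "{b. ?R u' b \<noteq> 0} \<subset> {b. ?R u b \<noteq> 0}"
      using R b1 by auto
    then have "card {b. ?R u' b \<noteq> 0} < card {b. ?R u b \<noteq> 0}"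
      by (rule psubset_card_mono[OF finite_representation])
    ultimately show ?thesis using less.hyps by blast
  qed
qed

text \<open>Every basis vector occurring in an element of \<open>U\<close> lies in \<open>U\<close>
  itself, so the basis expansion of that element stays inside \<open>U \<inter> B\<close>. An
  invariant subspace is thus determined by a subset of the basis.\<close>

lemma invariant_subspace_eq_span:
  assumes "subspace U" "U \<subseteq> span B"
    and "diag_scale w ` U \<subseteq> U" "inj_on w B"
  shows "U = span (U \<inter> B)"
proof
  show "U \<subseteq> span (U \<inter> B)"
  proof
    fix u assume u: "u \<in> U"
    have "representation B u b = 0 \<or> b \<in> U \<inter> B" for b
      using basis_in_invariant_subspace[OF assms u] representation_ne_zero by blast
    then have "(\<Sum>b | representation B u b \<noteq> 0. scale (representation B u b) b) \<in> span (U \<inter> B)"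
      by (intro span_sum span_scale span_base) auto
    then show "u \<in> span (U \<inter> B)"
      using sum_nonzero_representation_eq[OF independent_B] u assms(2) by auto
  qed
qed (use span_minimal[of "U \<inter> B" U] assms(1) in auto)

end

text \<open>All members of \<open>B'\<close> occurring in \<open>f b\<close> have the same
  eigenvalue \<open>w b * c\<close>, so the target operator acts on \<open>f b\<close> as that
  scalar. Linearity carries the relation from \<open>B\<close> to its span.\<close>

lemma diag_scale_map:
  assumes "finite_basis s B" "finite_basis s B'"
    and f: "linear_map_between s (module.span s B) (module.span s B') f"
    and w: "\<And>b b'. b \<in> B \<Longrightarrow> b' \<in> B' \<Longrightarrow> module.representation s B' (f b) b' \<noteq> 0 \<Longrightarrow> w' b' = w b * c"
    and v: "v \<in> module.span s B"
  shows "finite_basis.diag_scale s B' w' (f v) = s c (f (finite_basis.diag_scale s B w v))"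
proof -
  interpret B: finite_basis s B by fact
  interpret B': finite_basis s B' by fact
  have fs: "f x \<in> B.span B'" and fm: "f (s k x) = s k (f x)" if "x \<in> B.span B" for x k
    using f that by (auto simp: linear_map_between_def)
  have fa: "f (x + y) = f x + f y" if "x \<in> B.span B" "y \<in> B.span B" for x y
    using f that by (auto simp: linear_map_between_def)
  have f0: "f 0 = 0" using fa[OF B.span_zero B.span_zero] by simp
  \<comment> \<open>\<open>f\<close> is known to be linear on \<open>span B\<close> only, so
    membership in the span is carried through the induction.\<close>
  have f_sum: "f (\<Sum>b\<in>S. s (k b) b) = (\<Sum>b\<in>S. s (k b) (f b))" if "S \<subseteq> B" for S k
    using that
  proof (induction S rule: infinite_finite_induct)
    case (insert b S)
    then have "b \<in> B.span B" "(\<Sum>b\<in>S. s (k b) b) \<in> B.span B"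
      by (auto intro!: B.span_base B.span_sum B.span_scale)
    then show ?case using insert by (simp add: fa fm B.span_scale)
  qed (simp_all add: f0)
  have eigen: "B'.diag_scale w' (f b) = s (w b * c) (f b)" if b: "b \<in> B" for b
  proof -
    let ?R = "B.representation B' (f b)"
    have "B'.diag_scale w' (f b) = (\<Sum>b'\<in>B'. s (w b * c) (s (?R b') b'))"
      unfolding B'.diag_scale_def
      by (intro sum.cong refl) (use w[OF b] in \<open>force simp: mult.commute\<close>)
    also have "\<dots> = s (w b * c) (f b)"
      unfolding B.scale_sum_right[symmetric]
      by (subst B.sum_representation_eq[OF B'.independent_B fs B'.finite_B])
        (use B.span_base[OF b] in auto)
    finally show ?thesis .
  qed
  let ?r = "B.representation B v"
  have "f v = (\<Sum>b\<in>B. s (?r b) (f b))"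
    using f_sum[of B ?r] B.sum_representation_eq[OF B.independent_B v B.finite_B] by simp
  then have "B'.diag_scale w' (f v) = (\<Sum>b\<in>B. B'.diag_scale w' (s (?r b) (f b)))"
    by (simp add: B'.diag_scale_sum fs B.span_base B.span_scale)
  also have "\<dots> = (\<Sum>b\<in>B. s c (s (?r b * w b) (f b)))"
    by (intro sum.cong) (auto simp: B'.diag_scale_scale fs B.span_base eigen mult_ac)
  also have "\<dots> = s c (f (B.diag_scale w v))"
    unfolding B.scale_sum_right[symmetric] B.diag_scale_def f_sum[OF subset_refl] ..
  finally show ?thesis .
qed

text \<open>\<open>group_action\<close> asks for a homomorphism into \<open>BijGroup E\<close>. The
  inverse group element supplies the inverse map, and restricting to \<open>E\<close> makes each map
  extensional, as \<open>Bij E\<close> demands.\<close>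

lemma group_actionI:
  assumes "group G"
    and closed: "\<And>g x. g \<in> carrier G \<Longrightarrow> x \<in> E \<Longrightarrow> f g x \<in> E"
    and one: "\<And>x. x \<in> E \<Longrightarrow> f \<one>\<^bsub>G\<^esub> x = x"
    and mult: "\<And>g h x. g \<in> carrier G \<Longrightarrow> h \<in> carrier G \<Longrightarrow> x \<in> E \<Longrightarrow>
      f (g \<otimes>\<^bsub>G\<^esub> h) x = f g (f h x)"
  shows "group_action G E (\<lambda>g. \<lambda>x\<in>E. f g x)"
proof -
  interpret G: group G by fact
  have Bij: "(\<lambda>x\<in>E. f g x) \<in> Bij E" if g: "g \<in> carrier G" for g
  proof -
    have "bij_betw (f g) E E"
    proof (rule bij_betw_byWitness[where f' = "f (inv\<^bsub>G\<^esub> g)"])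
      show "\<forall>x\<in>E. f (inv\<^bsub>G\<^esub> g) (f g x) = x" "\<forall>x\<in>E. f g (f (inv\<^bsub>G\<^esub> g) x) = x"
        using g by (auto simp: mult[symmetric] one)
    qed (use g closed in auto)
    then show ?thesis by (simp add: Bij_def cong: bij_betw_cong)
  qed
  have "(\<lambda>g. \<lambda>x\<in>E. f g x) \<in> hom G (BijGroup E)"
  proof (rule homI)
    fix g h assume gh: "g \<in> carrier G" "h \<in> carrier G"
    have "(\<lambda>x\<in>E. f (g \<otimes>\<^bsub>G\<^esub> h) x) = compose E (\<lambda>x\<in>E. f g x) (\<lambda>x\<in>E. f h x)"
      using gh by (intro ext) (simp add: compose_def mult closed)
    then show "(\<lambda>x\<in>E. f (g \<otimes>\<^bsub>G\<^esub> h) x)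
        = (\<lambda>x\<in>E. f g x) \<otimes>\<^bsub>BijGroup E\<^esub> (\<lambda>x\<in>E. f h x)"
      using Bij gh by (simp add: BijGroup_def)
  qed (use Bij in \<open>simp add: BijGroup_def\<close>)
  then show ?thesis
    by (simp add: group_action_def group_hom_def group_hom_axioms_def assms(1) group_BijGroup)
qed

section \<open>Connected components of a digraph\<close>

lemma conn_components_iff:
  "C \<in> conn_components G \<longleftrightarrow> subgraph C G \<and> Digraph_Component.connected C \<and>
     (\<forall>H. subgraph C H \<and> subgraph H G \<and> Digraph_Component.connected H \<longrightarrow> H = C)"
  by (auto simp: conn_components_def pre_digraph.max_subgraph_def)

text \<open>Inside \<open>G\<close> or inside \<open>H\<close>, every vertex is linked in both
  directions to a fixed common vertex \<open>x\<close>; these walks persist in the symmetric closure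
  of the union.\<close>

lemma connected_union:
  assumes "wf_digraph G" "wf_digraph H" "compatible G H"
    and conn: "Digraph_Component.connected G" "Digraph_Component.connected H"
    and "verts G \<inter> verts H \<noteq> {}"
  shows "Digraph_Component.connected (Digraph_Component.union G H)"
proof -
  let ?U = "Digraph_Component.union G H"
  interpret U: wf_digraph ?U by (rule wellformed_union) fact+
  have sub: "subgraph (mk_symmetric G) (mk_symmetric ?U)"
    "subgraph (mk_symmetric H) (mk_symmetric ?U)"
    by (rule subgraph_mk_symmetric, rule subgraphs_of_union, fact+)+
  obtain x where x: "x \<in> verts G" "x \<in> verts H" using assms by auto
  interpret S: pair_wf_digraph "mk_symmetric ?U" by (rule U.wellformed_mk_symmetric)
  have "u \<rightarrow>\<^sup>*\<^bsub>mk_symmetric ?U\<^esub> x \<and> x \<rightarrow>\<^sup>*\<^bsub>mk_symmetric ?U\<^esub> u" if "u \<in> verts ?U" for u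
    using that x conn pre_digraph.reachable_mono[OF _ sub(1)] pre_digraph.reachable_mono[OF _ sub(2)]
    by (auto simp: connected_def strongly_connected_def)
  then show ?thesis
    using x by (intro U.connectedI) (auto intro: S.reachable_trans)
qed

text \<open>The union of \<open>C\<close> and \<open>H\<close> is a connected subgraph containing
  \<open>C\<close>, so maximality makes it equal to \<open>C\<close>.\<close>

lemma conn_component_absorbs:
  assumes C: "C \<in> conn_components G"
    and H: "subgraph H G" "Digraph_Component.connected H" "verts C \<inter> verts H \<noteq> {}"
  shows "subgraph H C"
proof -
  have C': "subgraph C G" "Digraph_Component.connected C"
    using C by (auto simp: conn_components_iff)
  have wf: "wf_digraph C" "wf_digraph H" "compatible C H"
    using C' H by (auto simp: subgraph_def compatible_def)
  have "subgraph (Digraph_Component.union C H) G"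
    using wf C' H by (simp add: subgraph_union_iff)
  then have "Digraph_Component.union C H = C"
    using C connected_union[OF wf C'(2) H(2,3)] subgraphs_of_union(1)[OF wf]
    by (auto simp: conn_components_iff)
  then show ?thesis using subgraphs_of_union(2)[OF wf] by simp
qed

lemma subgraph_antisym:
  "subgraph G H \<Longrightarrow> subgraph H G \<Longrightarrow> G = H"
  by (auto simp: subgraph_def compatible_def intro: pre_digraph.equality)

lemma conn_components_disjoint:
  assumes "C \<in> conn_components G" "D \<in> conn_components G" "verts C \<inter> verts D \<noteq> {}"
  shows "C = D"
  using assms conn_component_absorbs[of C G D] conn_component_absorbs[of D G C]
  by (intro subgraph_antisym) (auto simp: conn_components_iff)

text \<open>The arc together with its two ends is a connected subgraph meeting \<open>C\<close>,
  hence it is absorbed by \<open>C\<close>.\<close>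

lemma (in wf_digraph) arc_in_conn_component:
  assumes C: "C \<in> conn_components G" and e: "e \<in> arcs G" "tail G e \<in> verts C \<or> head G e \<in> verts C"
  shows "e \<in> arcs C"
proof -
  let ?H = "\<lparr>verts = {tail G e, head G e}, arcs = {e}, tail = tail G, head = head G\<rparr>"
  interpret H: wf_digraph ?H by unfold_locales auto
  interpret S: pair_wf_digraph "mk_symmetric ?H" by (rule H.wellformed_mk_symmetric)
  have "subgraph ?H G"
    using e H.wf_digraph wf_digraph by (auto simp: subgraph_def compatible_def)
  moreover have "Digraph_Component.connected ?H"
  proof (rule H.connectedI)
    have "tail G e \<rightarrow>\<^bsub>mk_symmetric ?H\<^esub> head G e" "head G e \<rightarrow>\<^bsub>mk_symmetric ?H\<^esub> tail G e"
      by (auto simp: mk_symmetric_def)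
    then show "u \<rightarrow>\<^sup>*\<^bsub>mk_symmetric ?H\<^esub> v" if "u \<in> verts ?H" "v \<in> verts ?H" for u v
      using that by (auto intro: S.reachable_adjI)
  qed simp
  ultimately have "subgraph ?H C"
    using conn_component_absorbs[OF C] e by auto
  then show ?thesis by (auto simp: subgraph_def)
qed

text \<open>Among the connected subgraphs containing \<open>x\<close>, one with the largest number
  of vertices plus arcs is maximal for inclusion. The one-vertex graph \<open>?X\<close> shows that
  there are such subgraphs.\<close>

lemma (in fin_digraph) in_some_conn_component:
  assumes x: "x \<in> verts G"
  shows "\<exists>C \<in> conn_components G. x \<in> verts C"
proof -
  define P where "P H \<longleftrightarrow> subgraph H G \<and> Digraph_Component.connected H \<and> x \<in> verts H" for H
  define size where "size H = card (verts H) + card (arcs H)" for H :: "('a, 'b) pre_digraph"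
  let ?X = "\<lparr>verts = {x}, arcs = {}, tail = tail G, head = head G\<rparr>"
  interpret X: wf_digraph ?X by unfold_locales auto
  interpret S: pair_wf_digraph "mk_symmetric ?X" by (rule X.wellformed_mk_symmetric)
  have "Digraph_Component.connected ?X"
    by (rule X.connectedI) auto
  then have "P ?X"
    using x X.wf_digraph wf_digraph by (auto simp: P_def subgraph_def compatible_def)
  moreover have "size H \<le> size G" if "P H" for H
    using that by (auto simp: P_def subgraph_def size_def intro!: add_mono card_mono)
  ultimately obtain C where C: "P C" "\<And>H. P H \<Longrightarrow> size H \<le> size C"
    using ex_has_greatest_nat[of P ?X size "Suc (size G)"] by (auto simp: less_Suc_eq_le)
  have "H = C" if H: "subgraph C H" "subgraph H G" "Digraph_Component.connected H" for H
  proof -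
    have "P H" using H C(1) by (auto simp: P_def subgraph_def)
    then have le: "size H \<le> size C" by (rule C(2))
    have fin: "finite (verts H)" "finite (arcs H)" and sub: "verts C \<subseteq> verts H" "arcs C \<subseteq> arcs H"
      using H finite_subset[OF _ finite_verts] finite_subset[OF _ finite_arcs]
      by (auto simp: subgraph_def)
    have "card (verts C) \<le> card (verts H)" "card (arcs C) \<le> card (arcs H)"
      using fin sub by (auto intro: card_mono)
    then have "card (verts C) = card (verts H)" "card (arcs C) = card (arcs H)"
      using le by (auto simp: size_def)
    then have "verts C = verts H" "arcs C = arcs H"
      using card_subset_eq fin sub by blast+
    then show ?thesis using H(1) by (auto simp: subgraph_def compatible_def intro: pre_digraph.equality)
  qed
  then show ?thesis using C(1) by (auto simp: conn_components_iff P_def)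
qed

text \<open>A component is determined by its vertex set: this set is nonempty, and distinct
  components have disjoint vertex sets.\<close>

lemma (in fin_digraph) finite_conn_components: "finite (conn_components G)"
proof (rule finite_imageD)
  show "finite (verts ` conn_components G)"
    by (rule finite_subset[of _ "Pow (verts G)"]) (auto simp: conn_components_iff subgraph_def)
  show "inj_on verts (conn_components G)"
  proof (rule inj_onI)
    fix C D assume "C \<in> conn_components G" "D \<in> conn_components G" "verts C = verts D"
    moreover from this(1) have "verts C \<noteq> {}"
      by (auto simp: conn_components_iff connected_conv)
    ultimately show "C = D" by (intro conn_components_disjoint) auto
  qed
qed

section \<open>Digraphs whose components are equioriented strings\<close>

lemma equioriented_string_labelling:
  assumes "digraph_iso (equioriented_string n) C"
  obtains f g where "bij_betw f {..n} (verts C)" "bij_betw g {..<n} (arcs C)"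
    "\<And>k. k < n \<Longrightarrow> tail C (g k) = f k" "\<And>k. k < n \<Longrightarrow> head C (g k) = f (Suc k)"
proof -
  obtain h where "pre_digraph.digraph_isomorphism (equioriented_string n) h"
    "C = app_iso h (equioriented_string n)"
    using assms by (auto simp: digraph_iso_def)
  then show thesis
    by (intro that[of "iso_verts h" "iso_arcs h"])
      (auto simp: pre_digraph.digraph_isomorphism_def equioriented_string_def bij_betw_def)
qed

locale string_digraph = fin_digraph G for G :: "('x, 'y) pre_digraph" +
  assumes string_components: "C \<in> conn_components G \<Longrightarrow> \<exists>n. digraph_iso (equioriented_string n) C"
begin

text \<open>The position of a vertex is its index on the unique string through it. The four facts
  are all that later arguments take from the string structure; the last one says that a vertex has
  at most one incoming arrow.\<close>

lemma string_position:
  obtains pos :: "'x \<Rightarrow> nat" where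
    "\<And>e. e \<in> arcs G \<Longrightarrow> pos (head G e) = Suc (pos (tail G e))"
    "\<And>x. x \<in> verts G \<Longrightarrow> pos x \<noteq> 0 \<Longrightarrow> \<exists>e\<in>arcs G. head G e = x"
    "\<And>C. C \<in> conn_components G \<Longrightarrow> inj_on pos (verts C)"
    "inj_on (head G) (arcs G)"
proof -
  let ?K = "conn_components G"
  have "\<forall>C\<in>?K. \<exists>n f g. bij_betw f {..n} (verts C) \<and> bij_betw g {..<n} (arcs C) \<and>
      (\<forall>k<n. tail C (g k) = f k \<and> head C (g k) = f (Suc k))"
    using string_components equioriented_string_labelling by metis
  then obtain n f g where f: "\<And>C. C \<in> ?K \<Longrightarrow> bij_betw (f C) {..n C} (verts C)"
    and g: "\<And>C. C \<in> ?K \<Longrightarrow> bij_betw (g C) {..<n C} (arcs C)"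
    and fg: "\<And>C k. C \<in> ?K \<Longrightarrow> k < n C \<Longrightarrow> tail C (g C k) = f C k \<and> head C (g C k) = f C (Suc k)"
    by metis
  obtain comp where comp: "\<And>x. x \<in> verts G \<Longrightarrow> comp x \<in> ?K \<and> x \<in> verts (comp x)"
    using in_some_conn_component by metis
  have compatible: "tail C = tail G" "head C = head G" "verts C \<subseteq> verts G" "arcs C \<subseteq> arcs G"
    "wf_digraph C"
    if "C \<in> ?K" for C
    using that by (auto simp: conn_components_iff subgraph_def compatible_def)
  have comp_eq: "comp x = C" if "C \<in> ?K" "x \<in> verts C" for C x
    using that comp[of x] compatible[of C] conn_components_disjoint[of "comp x" G C] by auto
  define pos where "pos x = the_inv_into {..n (comp x)} (f (comp x)) x" for x
  have pos_f: "pos (f C k) = k" if "C \<in> ?K" "k \<le> n C" for C k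
  proof -
    have "comp (f C k) = C" using f[OF that(1)] that by (intro comp_eq) (auto simp: bij_betw_def)
    then show ?thesis
      using f[OF that(1)] that by (simp add: pos_def bij_betw_def the_inv_into_f_f)
  qed
  have f_pos: "f C (pos x) = x" "pos x \<le> n C" if C: "C \<in> ?K" "x \<in> verts C" for C x
  proof -
    obtain k where "k \<le> n C" "x = f C k"
      using f[OF C(1)] C(2) by (auto simp: bij_betw_def)
    then show "f C (pos x) = x" "pos x \<le> n C" using pos_f C by auto
  qed
  \<comment> \<open>Components absorb the arcs they touch, so an arrow of \<open>G\<close> lies on
    the string of its tail and is one of the labelled arrows there.\<close>
  have arcE: "\<exists>C\<in>?K. \<exists>k<n C. e = g C k \<and> tail G e = f C k \<and> head G e = f C (Suc k)"
    if e: "e \<in> arcs G" for e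
  proof -
    let ?C = "comp (tail G e)"
    have C: "?C \<in> ?K" and "e \<in> arcs ?C"
      using comp[of "tail G e"] e arc_in_conn_component by auto
    then obtain k where k: "k < n ?C" "e = g ?C k"
      using g[OF C] by (auto simp: bij_betw_def)
    then show ?thesis using fg[OF C k(1)] C compatible by metis
  qed
  show thesis
  proof (rule that)
    show "pos (head G e) = Suc (pos (tail G e))" if "e \<in> arcs G" for e
      using arcE[OF that] pos_f by auto
  next
    fix x assume x: "x \<in> verts G" "pos x \<noteq> 0"
    let ?C = "comp x"
    obtain k where k: "pos x = Suc k" using x(2) by (cases "pos x") auto
    have C: "?C \<in> ?K" "x \<in> verts ?C" using comp x by auto
    have "k < n ?C" "f ?C (Suc k) = x" using f_pos[OF C] k by auto
    then have "head G (g ?C k) = x" "g ?C k \<in> arcs G"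
      using fg[OF C(1), of k] compatible[OF C(1)] g[OF C(1)] by (auto simp: bij_betw_def)
    then show "\<exists>e\<in>arcs G. head G e = x" by blast
  next
    show "inj_on pos (verts C)" if "C \<in> ?K" for C
      using f_pos[OF that] by (metis inj_onI)
  next
    show "inj_on (head G) (arcs G)"
    proof (rule inj_onI)
      fix e e' assume e: "e \<in> arcs G" "e' \<in> arcs G" "head G e = head G e'"
      obtain C k where 1: "C \<in> ?K" "k < n C" "e = g C k" "head G e = f C (Suc k)"
        using arcE[OF e(1)] by auto
      obtain C' k' where 2: "C' \<in> ?K" "k' < n C'" "e' = g C' k'" "head G e' = f C' (Suc k')"
        using arcE[OF e(2)] by auto
      have "f C (Suc k) \<in> verts C" "f C' (Suc k') \<in> verts C'"
        using f[OF 1(1)] f[OF 2(1)] 1(2) 2(2) by (auto dest: bij_betwE)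
      then have "C = C'" using comp_eq 1 2 e by metis
      moreover have "Suc k = Suc k'"
        using pos_f[of C "Suc k"] pos_f[of C' "Suc k'"] 1 2 e by auto
      ultimately show "e = e'" using 1 2 by simp
    qed
  qed
qed

end

text \<open>A case of unique factorisation: parity decides whether a factor 2 can be cancelled on
  both sides, and at the base only powers of 3 remain.\<close>

lemma three_power_times_two_power_inj:
  assumes "(3::nat) ^ i * 2 ^ p = 3 ^ j * 2 ^ q"
  shows "i = j \<and> p = q"
  using assms
proof (induction p arbitrary: q)
  case 0
  have "q = 0"
  proof (rule ccontr)
    assume "q \<noteq> 0"
    then have "even ((3::nat) ^ j * 2 ^ q)" by simp
    moreover have "odd ((3::nat) ^ i * 2 ^ 0)" by simp
    ultimately show False using 0 by metis
  qed
  then show ?case using 0 by simp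
next
  case (Suc p)
  have "q \<noteq> 0"
  proof
    assume "q = 0"
    then have "odd ((3::nat) ^ j * 2 ^ q)" by simp
    moreover have "even ((3::nat) ^ i * 2 ^ Suc p)" by simp
    ultimately show False using Suc.prems by metis
  qed
  then obtain q' where "q = Suc q'" by (cases q) auto
  then show ?case using Suc.IH[of q'] Suc.prems by simp
qed

lemma group_Cstar: "group Cstar"
proof (rule groupI)
  show "\<exists>y\<in>carrier Cstar. y \<otimes>\<^bsub>Cstar\<^esub> x = \<one>\<^bsub>Cstar\<^esub>" if "x \<in> carrier Cstar" for x
    using that by (intro bexI[of _ "inverse x"]) (auto simp: Cstar_def)
qed (auto simp: Cstar_def)

section \<open>The coefficient quiver and the weights of the basis vectors\<close>

locale straightened_rep =
  fixes Q :: "('i, 'a) pre_digraph"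
    and M :: "('i, 'a, 'v::ab_group_add) quiver_rep"
    and B :: "'i \<Rightarrow> 'v set"
  assumes fin_digraph_Q: "fin_digraph Q"
    and is_rep: "is_rep Q M"
    and straightening_basis: "straightening_basis Q M B"
begin

abbreviation "K \<equiv> coeff_quiver Q M B"

interpretation Q: fin_digraph Q by (rule fin_digraph_Q)

interpretation vector_space "scl M"
  using is_rep by (simp add: is_rep_def)

text \<open>Finiteness of \<open>B i\<close> follows from its independence inside a finitely spanned
  space.\<close>

lemma finite_basis: "i \<in> verts Q \<Longrightarrow> finite_basis (scl M) (B i)"
  and span_B: "i \<in> verts Q \<Longrightarrow> module.span (scl M) (B i) = rep_space M i"
proof -
  assume i: "i \<in> verts Q"
  show span: "span (B i) = rep_space M i"
    using straightening_basis i by (auto simp: straightening_basis_def is_basis_def)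
  have indep: "independent (B i)"
    using straightening_basis i by (auto simp: straightening_basis_def is_basis_def)
  obtain S where "finite S" "span S = rep_space M i"
    using is_rep i by (auto simp: is_rep_def)
  then have "finite (B i)"
    using independent_span_bound[of S "B i"] indep span span_superset by metis
  then show "finite_basis (scl M) (B i)"
    using indep by unfold_locales auto
qed

lemma linear_arc_map:
  "a \<in> arcs Q \<Longrightarrow> linear_map_between (scl M) (rep_space M (tail Q a)) (rep_space M (head Q a)) (arc_map M a)"
  using is_rep by (auto simp: is_rep_def)

lemma verts_K: "verts K = Sigma (verts Q) B"
  and head_K: "head K (a, b, b') = (head Q a, b')"
  and tail_K: "tail K (a, b, b') = (tail Q a, b)"
  and arcs_K: "(a, b, b') \<in> arcs K \<longleftrightarrow> a \<in> arcs Q \<and> b \<in> B (tail Q a) \<and> b' \<in> B (head Q a) \<and>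
    module.representation (scl M) (B (head Q a)) (arc_map M a b) b' \<noteq> 0"
  by (auto simp: coeff_quiver_def)

lemma string_digraph_K: "string_digraph K"
proof
  have finB: "finite (B i)" if "i \<in> verts Q" for i
    using finite_basis[OF that] by (simp add: finite_basis_def finite_basis_axioms_def)
  then show "finite (verts K)" by (auto simp: verts_K)
  let ?B = "\<Union>i\<in>verts Q. B i"
  have "arcs K \<subseteq> arcs Q \<times> ?B \<times> ?B"
    using Q.tail_in_verts Q.head_in_verts by (fastforce simp: arcs_K)
  then show "finite (arcs K)"
    by (rule finite_subset) (use finB in auto)
  show "tail K e \<in> verts K" "head K e \<in> verts K" if "e \<in> arcs K" for e
    using that by (cases e; auto simp: verts_K arcs_K tail_K head_K)+
  show "\<exists>n. digraph_iso (equioriented_string n) C" if "C \<in> conn_components K" for C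
    using straightening_basis that by (auto simp: straightening_basis_def)
qed

interpretation K: string_digraph K by (rule string_digraph_K)

text \<open>The rule \<open>scaled_by.start\<close> looks only at arcs of \<open>C\<close>; every
  arc of \<open>K\<close> ending in \<open>C\<close> belongs to \<open>C\<close>, so such a vertex
  has no incoming arrow in \<open>K\<close> at all.\<close>

lemma start_no_arc:
  assumes "C \<in> conn_components K" "x \<in> verts C" "\<forall>\<alpha>\<in>arcs C. head C \<alpha> \<noteq> x" "e \<in> arcs K"
  shows "head K e \<noteq> x"
  using assms K.arc_in_conn_component[OF assms(1,4)]
  by (auto simp: conn_components_iff subgraph_def compatible_def)

text \<open>A starting vertex has no incoming arrow and lies in one component only; any other vertex
  has exactly one incoming arrow. So the last rule of a derivation is forced, which justifies the
  definite description in \<open>weight\<close>.\<close>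

lemma scaled_by_unique:
  assumes "scaled_by Q M B t x w" "scaled_by Q M B t x w'"
  shows "w = w'"
  using assms
proof (induction arbitrary: w')
  case (start C x)
  from start(4) show ?case
  proof cases
    case (start C')
    then show ?thesis
      using conn_components_disjoint[of C K C'] \<open>C \<in> _\<close> \<open>x \<in> verts C\<close> by auto
  next
    case (step y w a b b')
    then show ?thesis using start_no_arc[OF start(1-3) step(4)] by simp
  qed
next
  case (step x w a b b')
  from step.prems show ?case
  proof cases
    case (start C)
    then show ?thesis using start_no_arc[OF start(2-4) step.hyps(2)] by simp
  next
    case (step y v a2 b2 b2')
    \<comment> \<open>\<open>string_position\<close> is invoked for uniqueness of the incoming
      arrow, so both derivations end with the same arrow.\<close>
    obtain pos :: "'i \<times> 'v \<Rightarrow> nat" where "inj_on (head K) (arcs K)"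
      by (rule K.string_position) blast
    then have "(a2, b2, b2') = (a, b, b')"
      using step(1,4) \<open>(a, b, b') \<in> arcs K\<close> by (metis inj_onD)
    then show ?thesis using step step.IH \<open>tail K (a, b, b') = x\<close> by auto
  qed
qed

text \<open>Induction on the position, walking back along the string; at position 0 no arrow comes
  in, because heads have positive position.\<close>

lemma scaled_by_exists:
  assumes "x \<in> verts K"
  shows "\<exists>w. scaled_by Q M B t x w"
proof -
  obtain pos :: "'i \<times> 'v \<Rightarrow> nat" where
    pos_head: "\<And>e. e \<in> arcs K \<Longrightarrow> pos (head K e) = Suc (pos (tail K e))" and
    pos_nz: "\<And>x. x \<in> verts K \<Longrightarrow> pos x \<noteq> 0 \<Longrightarrow> \<exists>e\<in>arcs K. head K e = x"
    by (rule K.string_position) blast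
  show ?thesis using assms
  proof (induction "pos x" arbitrary: x rule: less_induct)
    case less
    show ?case
    proof (cases "pos x = 0")
      case True
      obtain C where C: "C \<in> conn_components K" "x \<in> verts C"
        using K.in_some_conn_component[OF less.prems] by blast
      have "\<forall>\<alpha>\<in>arcs C. head C \<alpha> \<noteq> x"
        using C(1) pos_head True
        by (auto simp: conn_components_iff subgraph_def compatible_def)
      then show ?thesis using scaled_by.start[OF C] by blast
    next
      case False
      obtain a b b' where e: "(a, b, b') \<in> arcs K" "head K (a, b, b') = x"
        using pos_nz[OF less.prems False] by auto
      then obtain w where "scaled_by Q M B t (tail K (a, b, b')) w"
        using less.hyps[OF _ K.tail_in_verts[OF e(1)]] pos_head[OF e(1)] e(2) by auto
      then show ?thesis using scaled_by.step[OF _ e(1) refl] e(2) by metis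
    qed
  qed
qed

lemma weight_eqI: "scaled_by Q M B t x w \<Longrightarrow> weight Q M B t x = w"
  unfolding weight_def by (intro the_equality scaled_by_unique)

lemma weight_start:
  "C \<in> conn_components K \<Longrightarrow> x \<in> verts C \<Longrightarrow> \<forall>\<alpha>\<in>arcs C. head C \<alpha> \<noteq> x \<Longrightarrow>
    weight Q M B t x = fst t C"
  by (intro weight_eqI scaled_by.start)

lemma weight_step:
  assumes "(a, b, b') \<in> arcs K"
  shows "weight Q M B t (head Q a, b') = weight Q M B t (tail Q a, b) * snd t a"
proof -
  obtain w where "scaled_by Q M B t (tail Q a, b) w"
    using scaled_by_exists[of "(tail Q a, b)" t] K.tail_in_verts[OF assms] by (auto simp: tail_K)
  then show ?thesis
    using scaled_by.step[OF _ assms] weight_eqI by (metis head_K tail_K)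
qed

lemma string_induct [consumes 1, case_names start step]:
  assumes "x \<in> verts K"
    and start: "\<And>C x. C \<in> conn_components K \<Longrightarrow> x \<in> verts C \<Longrightarrow>
      \<forall>\<alpha>\<in>arcs C. head C \<alpha> \<noteq> x \<Longrightarrow> P x"
    and step: "\<And>a b b'. (a, b, b') \<in> arcs K \<Longrightarrow> P (tail Q a, b) \<Longrightarrow> P (head Q a, b')"
  shows "P x"
proof -
  \<comment> \<open>Only the shape of the derivation matters, so any torus element serves; rule
    induction then follows the string.\<close>
  obtain w where "scaled_by Q M B undefined x w"
    using scaled_by_exists assms(1) by blast
  then show ?thesis
    by induction (use start step in \<open>auto simp: head_K tail_K\<close>)
qed

text \<open>Torus elements have prescribed values only on \<open>arcs (supp Q M)\<close>. A nonzero
  coefficient forces a nonzero map, so every arrow of \<open>K\<close> has a genuine torus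
  coordinate.\<close>

lemma arc_in_supp:
  assumes "(a, b, b') \<in> arcs K"
  shows "a \<in> arcs (supp Q M)"
proof -
  have a: "a \<in> arcs Q" "b \<in> B (tail Q a)"
    "representation (B (head Q a)) (arc_map M a b) b' \<noteq> 0"
    using assms by (auto simp: arcs_K)
  then have "arc_map M a b \<noteq> 0" using representation_zero by force
  moreover have "b \<in> rep_space M (tail Q a)"
    using a span_base[of b "B (tail Q a)"] span_B[of "tail Q a"] by simp
  ultimately show ?thesis using a(1) by (auto simp: supp_def)
qed

section \<open>The torus and its characters\<close>

abbreviation "T \<equiv> torus Q M B"

lemma torus_simps:
  "carrier T = (conn_components K \<rightarrow>\<^sub>E UNIV - {0}) \<times> (arcs (supp Q M) \<rightarrow>\<^sub>E UNIV - {0})"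
  "\<one>\<^bsub>T\<^esub> = (\<lambda>C\<in>conn_components K. 1, \<lambda>a\<in>arcs (supp Q M). 1)"
  "t \<otimes>\<^bsub>T\<^esub> u = (\<lambda>C\<in>conn_components K. fst t C * fst u C, \<lambda>a\<in>arcs (supp Q M). snd t a * snd u a)"
  by (auto simp: torus_def DirProd_def Cstar_def split: prod.splits)

lemma group_torus: "group T"
  unfolding torus_def by (intro DirProd_group product_group group_Cstar)

text \<open>A weight is a product of torus coordinates collected along a string, so multiplicativity
  propagates from the start across each arrow.\<close>

lemma weight_mult:
  "x \<in> verts K \<Longrightarrow> weight Q M B (t \<otimes>\<^bsub>T\<^esub> u) x = weight Q M B t x * weight Q M B u x"
  by (induction x rule: string_induct)
    (auto simp: weight_start weight_step torus_simps arc_in_supp)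

lemma weight_one: "x \<in> verts K \<Longrightarrow> weight Q M B \<one>\<^bsub>T\<^esub> x = 1"
  by (induction x rule: string_induct)
    (auto simp: weight_start weight_step torus_simps arc_in_supp)

lemma weight_nonzero: "x \<in> verts K \<Longrightarrow> t \<in> carrier T \<Longrightarrow> weight Q M B t x \<noteq> 0"
proof (induction x rule: string_induct)
  case (start C x)
  then show ?case by (auto simp: weight_start torus_simps PiE_iff)
next
  case (step a b b')
  then show ?case using arc_in_supp[OF step(1)] by (auto simp: weight_step torus_simps PiE_iff)
qed

lemma act_apply:
  assumes "i \<in> verts Q"
  shows "act Q M B t U i =
    finite_basis.diag_scale (scl M) (B i) (\<lambda>b. weight Q M B t (i, b)) ` U i"
proof -
  interpret Bi: finite_basis "scl M" "B i" by (rule finite_basis[OF assms])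
  show ?thesis using assms by (simp add: act_def act_vec_def Bi.diag_scale_def)
qed

section \<open>The action on the quiver Grassmannian\<close>

abbreviation "Gr e \<equiv> quiver_Grassmannian Q M e"

lemma Gr_iff:
  "U \<in> Gr e \<longleftrightarrow> U \<in> extensional (verts Q) \<and>
     (\<forall>i\<in>verts Q. subspace (U i) \<and> U i \<subseteq> rep_space M i \<and> int (dim (U i)) = e i) \<and>
     (\<forall>a\<in>arcs Q. arc_map M a ` U (tail Q a) \<subseteq> U (head Q a))"
  by (auto simp: quiver_Grassmannian_def PiE_iff)

text \<open>Nonzero weights preserve dimensions, and the arrow maps commute with the diagonal
  operators up to a nonzero scalar, which a subspace does not see.\<close>

lemma act_in_Gr:
  assumes t: "t \<in> carrier T" and U: "U \<in> Gr e"
  shows "act Q M B t U \<in> Gr e"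
  unfolding Gr_iff
proof (intro conjI ballI)
  show "act Q M B t U \<in> extensional (verts Q)" by (simp add: act_def)
  fix i assume i: "i \<in> verts Q"
  interpret Bi: finite_basis "scl M" "B i" by (rule finite_basis[OF i])
  have Ui: "subspace (U i)" "U i \<subseteq> span (B i)" "int (dim (U i)) = e i"
    using U i span_B[OF i] by (auto simp: Gr_iff)
  show "subspace (act Q M B t U i)"
    unfolding act_apply[OF i] by (rule Bi.subspace_diag_scale_image[OF Ui(1,2)])
  show "act Q M B t U i \<subseteq> rep_space M i"
    unfolding act_apply[OF i] span_B[OF i, symmetric] using Bi.diag_scale_in_span by auto
  have "weight Q M B t (i, b) \<noteq> 0" if "b \<in> B i" for b
    using weight_nonzero[OF _ t] i that by (simp add: verts_K)
  then show "int (dim (act Q M B t U i)) = e i"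
    unfolding act_apply[OF i] using Bi.dim_diag_scale_image[OF Ui(2)] Ui(3) by simp
next
  let ?w = "\<lambda>i b. weight Q M B t (i, b)"
  let ?D = "\<lambda>i. finite_basis.diag_scale (scl M) (B i) (?w i)"
  fix a assume a: "a \<in> arcs Q"
  let ?i = "tail Q a" and ?j = "head Q a" and ?f = "arc_map M a"
  have ij: "?i \<in> verts Q" "?j \<in> verts Q" using a by auto
  interpret Bi: finite_basis "scl M" "B ?i" by (rule finite_basis[OF ij(1)])
  interpret Bj: finite_basis "scl M" "B ?j" by (rule finite_basis[OF ij(2)])
  have U': "U ?i \<subseteq> span (B ?i)" "subspace (U ?j)" "?f ` U ?i \<subseteq> U ?j"
    "U ?j \<subseteq> span (B ?j)"
    using U ij a span_B by (auto simp: Gr_iff)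
  have lin: "linear_map_between (scl M) (span (B ?i)) (span (B ?j)) ?f"
    using linear_arc_map[OF a] span_B ij by simp
  show "?f ` act Q M B t U ?i \<subseteq> act Q M B t U ?j"
    unfolding act_apply[OF ij(1)] act_apply[OF ij(2)]
  proof clarify
    fix u assume u: "u \<in> U ?i"
    show "?f (?D ?i u) \<in> ?D ?j ` U ?j"
    proof (cases "a \<in> arcs (supp Q M)")
      \<comment> \<open>Outside the support \<open>snd t a\<close> is the default
        \<open>undefined\<close>, which need not be invertible; here the arrow map itself vanishes,
        and 0 lies in the image of \<open>U ?j\<close>.\<close>
      case False
      then have "?f (?D ?i u) = 0"
        using a Bi.diag_scale_in_span span_B[OF ij(1)] by (auto simp: supp_def)
      then show ?thesis
        using subspace_0[OF U'(2)] Bj.diag_scale_zero by (metis image_eqI)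
    next
      case True
      define \<nu> where "\<nu> = snd t a"
      have \<nu>: "\<nu> \<noteq> 0" using t True by (auto simp: torus_simps PiE_iff \<nu>_def)
      have "?D ?j (?f u) = scl M \<nu> (?f (?D ?i u))"
      proof (rule diag_scale_map[OF finite_basis[OF ij(1)] finite_basis[OF ij(2)] lin])
        show "?w ?j b' = ?w ?i b * \<nu>"
          if "b \<in> B ?i" "b' \<in> B ?j" "representation (B ?j) (?f b) b' \<noteq> 0" for b b'
          unfolding \<nu>_def using that a by (intro weight_step) (simp add: arcs_K)
      qed (use u U' in auto)
      \<comment> \<open>Moving the inverse scalar inside the operator exhibits the vector as the
        image of an element of \<open>U ?j\<close>.\<close>
      then have "?f (?D ?i u) = scl M (inverse \<nu>) (?D ?j (?f u))"
        using \<nu> by simp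
      also have "\<dots> = ?D ?j (scl M (inverse \<nu>) (?f u))"
        using u U' by (intro Bj.diag_scale_scale[symmetric]) auto
      finally show ?thesis
        using u U' subspace_scale[OF U'(2)] by auto
    qed
  qed
qed

lemma act_one:
  assumes "U \<in> Gr e"
  shows "act Q M B \<one>\<^bsub>T\<^esub> U = U"
proof (rule extensionalityI[of _ "verts Q"])
  fix i assume i: "i \<in> verts Q"
  interpret Bi: finite_basis "scl M" "B i" by (rule finite_basis[OF i])
  have "Bi.diag_scale (\<lambda>b. weight Q M B \<one>\<^bsub>T\<^esub> (i, b)) u = u" if "u \<in> U i" for u
    using that assms i span_B[OF i]
    by (intro Bi.diag_scale_one) (auto simp: Gr_iff weight_one verts_K)
  then show "act Q M B \<one>\<^bsub>T\<^esub> U i = U i"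
    by (simp add: act_apply[OF i])
qed (use assms in \<open>auto simp: Gr_iff act_def\<close>)

lemma act_mult:
  "act Q M B (t \<otimes>\<^bsub>T\<^esub> u) U = act Q M B t (act Q M B u U)"
proof (rule extensionalityI[of _ "verts Q"])
  fix i assume i: "i \<in> verts Q"
  interpret Bi: finite_basis "scl M" "B i" by (rule finite_basis[OF i])
  have "Bi.diag_scale (\<lambda>b. weight Q M B (t \<otimes>\<^bsub>T\<^esub> u) (i, b)) v
      = Bi.diag_scale (\<lambda>b. weight Q M B t (i, b)) (Bi.diag_scale (\<lambda>b. weight Q M B u (i, b)) v)"
    for v
    unfolding Bi.diag_scale_compose
    by (rule Bi.diag_scale_cong) (use i in \<open>simp add: weight_mult verts_K\<close>)
  then show "act Q M B (t \<otimes>\<^bsub>T\<^esub> u) U i = act Q M B t (act Q M B u U) i"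
    by (simp add: act_apply[OF i] image_image)
qed (auto simp: act_def)

lemma group_action_torus:
  "group_action T (Gr e) (\<lambda>t. \<lambda>U\<in>Gr e. act Q M B t U)"
  by (rule group_actionI) (auto simp: group_torus act_in_Gr act_one act_mult)

section \<open>A torus element with distinct weights, and finiteness of the fixed points\<close>

lemma separating_torus_element:
  obtains t where "t \<in> carrier T" "inj_on (weight Q M B t) (verts K)"
proof -
  obtain idx :: "('i \<times> 'v, 'a \<times> 'v \<times> 'v) pre_digraph \<Rightarrow> nat"
    where idx: "inj_on idx (conn_components K)"
    using finite_imp_inj_to_nat_seg[OF K.finite_conn_components] by blast
  obtain pos :: "'i \<times> 'v \<Rightarrow> nat" where
    pos_head: "\<And>e. e \<in> arcs K \<Longrightarrow> pos (head K e) = Suc (pos (tail K e))" and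
    pos_nz: "\<And>x. x \<in> verts K \<Longrightarrow> pos x \<noteq> 0 \<Longrightarrow> \<exists>e\<in>arcs K. head K e = x" and
    pos_inj: "\<And>C. C \<in> conn_components K \<Longrightarrow> inj_on pos (verts C)"
    by (rule K.string_position) blast
  define t :: "(('i \<times> 'v, 'a \<times> 'v \<times> 'v) pre_digraph \<Rightarrow> complex) \<times> ('a \<Rightarrow> complex)"
    where "t = (\<lambda>C\<in>conn_components K. 3 ^ idx C, \<lambda>a\<in>arcs (supp Q M). 2)"
  have t: "t \<in> carrier T" by (auto simp: t_def torus_simps)
  \<comment> \<open>The component is quantified inside the claim so that the induction hypothesis at
    the tail of an arrow can be used with the component of its head. The value is written as
    \<open>of_nat\<close> so that equal weights give an equation between natural numbers.\<close>
  have weight: "\<forall>C\<in>conn_components K. x \<in> verts C \<longrightarrow> weight Q M B t x = of_nat (3 ^ idx C * 2 ^ pos x)"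
    if "x \<in> verts K" for x
    using that
  proof (induction x rule: string_induct)
    case (start C x)
    have "x \<in> verts K" using start by (auto simp: conn_components_iff subgraph_def)
    \<comment> \<open>A nonzero position would provide an incoming arrow, so the power of 2 is 1 at
      a start.\<close>
    then have "pos x = 0" using start_no_arc[OF start] pos_nz by blast
    then show ?case
      using start conn_components_disjoint[OF start(1)] by (auto simp: weight_start t_def)
  next
    case (step a b b')
    show ?case
    proof (intro ballI impI)
      fix C assume C: "C \<in> conn_components K" "(head Q a, b') \<in> verts C"
      have "(a, b, b') \<in> arcs C"
        using K.arc_in_conn_component[OF C(1) step(1)] C(2) by (simp add: head_K)
      then have "tail K (a, b, b') \<in> verts C"
        using C(1) wf_digraph.tail_in_verts[of C]
        by (metis compatible_tail conn_components_iff subgraph_def)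
      then have "weight Q M B t (tail Q a, b) = of_nat (3 ^ idx C * 2 ^ pos (tail Q a, b))"
        using step C(1) by (simp add: tail_K)
      moreover have "pos (head Q a, b') = Suc (pos (tail Q a, b))"
        using pos_head[OF step(1)] by (simp add: head_K tail_K)
      ultimately show "weight Q M B t (head Q a, b') = of_nat (3 ^ idx C * 2 ^ pos (head Q a, b'))"
        using arc_in_supp[OF step(1)] by (simp add: weight_step[OF step(1)] t_def)
    qed
  qed
  have "inj_on (weight Q M B t) (verts K)"
  proof (rule inj_onI)
    fix x y assume xy: "x \<in> verts K" "y \<in> verts K" "weight Q M B t x = weight Q M B t y"
    obtain C D where C: "C \<in> conn_components K" "x \<in> verts C"
      and D: "D \<in> conn_components K" "y \<in> verts D"
      using K.in_some_conn_component xy(1,2) by meson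
    have "(of_nat (3 ^ idx C * 2 ^ pos x) :: complex) = of_nat (3 ^ idx D * 2 ^ pos y)"
      using weight[OF xy(1)] weight[OF xy(2)] C D xy(3) by metis
    then have "3 ^ idx C * 2 ^ pos x = (3::nat) ^ idx D * 2 ^ pos y"
      by (simp only: of_nat_eq_iff)
    then have "idx C = idx D" "pos x = pos y"
      using three_power_times_two_power_inj by blast+
    then show "x = y"
      using C D inj_onD[OF idx] inj_onD[OF pos_inj[OF C(1)]] by metis
  qed
  with t show thesis by (rule that)
qed

text \<open>Being fixed by the single separating element already forces each \<open>U i\<close> to
  be the span of a subset of \<open>B i\<close>, which leaves finitely many choices at each of
  finitely many vertices.\<close>

lemma finite_fixed_points:
  "finite {U \<in> Gr e. \<forall>t\<in>carrier T. act Q M B t U = U}"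
proof -
  obtain t where t: "t \<in> carrier T" and inj: "inj_on (weight Q M B t) (verts K)"
    by (rule separating_torus_element)
  have "{U \<in> Gr e. \<forall>t\<in>carrier T. act Q M B t U = U} \<subseteq> (\<Pi>\<^sub>E i\<in>verts Q. span ` Pow (B i))"
  proof clarify
    fix U assume U: "U \<in> Gr e" "\<forall>t\<in>carrier T. act Q M B t U = U"
    show "U \<in> (\<Pi>\<^sub>E i\<in>verts Q. span ` Pow (B i))"
    proof (rule PiE_I)
      fix i assume i: "i \<in> verts Q"
      interpret Bi: finite_basis "scl M" "B i" by (rule finite_basis[OF i])
      have "Bi.diag_scale (\<lambda>b. weight Q M B t (i, b)) ` U i = U i"
        using U(2) t act_apply[OF i] by metis
      moreover have "inj_on (\<lambda>b. weight Q M B t (i, b)) (B i)"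
        using i inj by (auto simp: inj_on_def verts_K)
      ultimately have "U i = span (U i \<inter> B i)"
        using U(1) i span_B[OF i] by (intro Bi.invariant_subspace_eq_span) (auto simp: Gr_iff)
      then show "U i \<in> span ` Pow (B i)" by blast
    qed (use U(1) in \<open>auto simp: Gr_iff extensional_def\<close>)
  qed
  moreover have "finite (\<Pi>\<^sub>E i\<in>verts Q. span ` Pow (B i))"
    using finite_basis by (intro finite_PiE) (auto simp: finite_basis_def finite_basis_axioms_def)
  ultimately show ?thesis by (rule finite_subset)
qed

end

theorem lemma4p6:
  fixes Q :: "('i, 'a) pre_digraph"
    and M :: "('i, 'a, 'v::ab_group_add) quiver_rep"
    and B :: "'i \<Rightarrow> 'v set"
    and e :: "'i \<Rightarrow> int"
  assumes "fin_digraph Q"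
    and "is_rep Q M"
    and "straight Q M"
    and "straightening_basis Q M B"
  shows "group_action (torus Q M B) (quiver_Grassmannian Q M e)
           (\<lambda>t. \<lambda>U\<in>quiver_Grassmannian Q M e. act Q M B t U)
       \<and> finite {U \<in> quiver_Grassmannian Q M e. \<forall>t\<in>carrier (torus Q M B). act Q M B t U = U}"
proof -
  interpret straightened_rep Q M B
    using assms by (intro straightened_rep.intro)
  show ?thesis using group_action_torus finite_fixed_points by blast
qed

end
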